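(* Let $\lambda,\lambda'\in\mathbb{Z}$ and let $\alpha$ be a critical point (so $(\alpha^3-\alpha-1)(\alpha^3+2\alpha^2-\alpha-1)=0$), with branches chosen as in the context. The formal stationary phase expansion (defined in the context) of $\hat Z^{(\lambda,\lambda')}_{(-2,3,7)}(\tau)$ at $\alpha$, where $\hbar=2\pi i\tau$, is $$e^{\frac{2\pi i\lambda'\log\alpha}{\hbar}}\,\hat\Phi^{(\alpha)}(\lambda,\hbar),$$ where, for a suitable choice of the square root, $$ \hat\Phi^{(\alpha)}(\lambda,\hbar)=e^{\frac{V_{0,0}(\alpha)}{\hbar}}\,\Phi^{(\alpha)}(\lambda,\hbar),\qquad \Phi^{(\alpha)}(\lambda,\hbar)=\frac{\alpha^\lambda}{\sqrt{i\,\Delta(\alpha)}}\sum_{k=0}^\infty c_k(\alpha,\lambda)\,\hbar^k , $$ $$ V_{0,0}(\alpha)=2\operatorname{Li}_2(-\alpha)-\operatorname{Li}_2(\alpha^{-2}),\qquad \Delta(\alpha)=-2\alpha^5+12\alpha^3-2\alpha^2-16\alpha-10, $$ and the $c_k(\alpha,\lambda)\in\mathbb{Q}(\alpha)[\lambda]$ are polynomials in $\lambda$ of degree $2k$ with coefficients in $\mathbb{Q}(\alpha)$, with $c_0(\alpha,\lambda)=1$, given explicitly by the formal Gaussian integration described in the context.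
   Context: **State integral.** For $\tau=b^2\in\mathbb{C}\setminus(-\infty,0]$ with $\operatorname{Re}b>0$, let $c_b=\frac i2(b+b^{-1})$, $q=e^{2\pi i\tau}$, $\tilde q=e^{-2\pi i/\tau}$, $\hbar=2\pi i\tau$. $\Phi_b$ is Faddeev's quantum dilogarithm: the meromorphic continuation in $x$ of $\exp\Big(\frac14\int_{\mathbb{R}+i\epsilon_0}\frac{e^{-2ixw}}{\sinh(bw)\sinh(b^{-1}w)}\frac{dw}{w}\Big)$. Define $$Z^{(\lambda,\lambda')}_{(-2,3,7)}(\tau)=\int_{\mathbb{R}+\frac{c_b}{2}+i\varepsilon}\Phi_b(x)^2\Phi_b(2x-c_b)e^{-\pi i(2x-c_b)^2+2\pi(\lambda b-\lambda' b^{-1})x}dx$$ (small $\varepsilon>0$; ends of the contour shifted upward if necessary, without crossing poles, so that the integral converges absolutely), and $\hat Z^{(\lambda,\lambda')}_{(-2,3,7)}(\tau)=(\tilde q/q)^{1/24}Z^{(\lambda,\lambda')}_{(-2,3,7)}(\tau)$. Using $\Phi_b(x)\Phi_b(-x)=e^{\pi i x^2}(q/\tilde q)^{1/24}$, $$\hat Z^{(\lambda,\lambda')}_{(-2,3,7)}(\tau)=\int\frac{\Phi_b(x)^2}{\Phi_b(-2x+c_b)}e^{2\pi(\lambda b-\lambda' b^{-1})x}dx .$$ **Formal integrand.** Substitute $x=\frac{z}{2\pi b}$ and replace $\Phi_b$ by its asymptotic series $\Phi_b\big(\frac{z}{2\pi b}\big)\sim\exp\Big(\sum_{n\ge0}\hbar^{2n-1}\frac{B_{2n}(1/2)}{(2n)!}\operatorname{Li}_{2-2n}(-e^z)\Big)$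 ($B_{2n}(\cdot)$ Bernoulli polynomials), and expand in $\hbar$ using $\operatorname{Li}_{2-2n}(e^{-2z+s})=\sum_{k\ge0}\operatorname{Li}_{2-2n-k}(e^{-2z})\frac{s^k}{k!}$. This gives the formal integral $$\frac{i}{\sqrt{2\pi i\hbar}}\int\exp\Big(\lambda z+\frac{2\pi i\lambda'}{\hbar}z+V(z,\hbar)\Big)dz,\qquad V(z,\hbar)=\sum_{n\ge0}\hbar^{2n-1}\frac{B_{2n}(1/2)}{(2n)!}\Big(2\operatorname{Li}_{2-2n}(-e^z)-\operatorname{Li}_{2-2n}(e^{-2z+\hbar/2})\Big)=\sum_{n\ge0}\hbar^{n-1}V_n(z).$$ In particular $V_0(z)=2\operatorname{Li}_2(-e^z)-\operatorname{Li}_2(e^{-2z})$ and $V_1(z)=-\frac12\operatorname{Li}_1(e^{-2z})=\frac12\log(1-e^{-2z})$. **Critical points.** A critical point is $\alpha=e^z$ with $V_0'(z)+2\pi i\lambda'=0$; such $\alpha$ satisfy $(\alpha^3-\alpha-1)(\alpha^3+2\alpha^2-\alpha-1)=0$. Branches of $\log\alpha$ and of the polylogarithms near $z=\log\alpha$ are fixed so that $V_0'(\log\alpha)+2\pi i\lambda'=0$ holds. Write $V_n(z)=\sum_{m\ge0}V_{n,m}(z-\log\alpha)^m$ (so $V_{0,1}=-2\pi i\lambda'$, $V_{0,0}=V_0(\log\alpha)$). **Formal stationary phase expansion at $\alpha$.** Put $z=\log\alpha+\hbar^{1/2}y$, giving $$\frac{i\,\alpha^\lambda e^{\frac{V_{0,0}+2\pi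 i\lambda'\log\alpha}{\hbar}}}{\sqrt{2\pi i}}\int e^{V_{0,2}y^2}\exp\Big(\lambda\hbar^{1/2}y+\sum_{m\ge3}\hbar^{\frac m2-1}y^mV_{0,m}+\sum_{n\ge1,\,m\ge0}\hbar^{n-1+\frac m2}y^mV_{n,m}\Big)dy .$$ Factor out $e^{V_{1,0}}$ (the term $n=1,m=0$), expand the remaining second exponential as a power series in $\hbar^{1/2}$ with coefficients polynomial in $y$ and $\lambda$, and integrate term by term by the formal Gaussian rules $\int e^{V_{0,2}y^2}y^{2k}dy=\sqrt{\frac{\pi}{-V_{0,2}}}\,\frac{(2k-1)!!}{(-2V_{0,2})^k}$, $\int e^{V_{0,2}y^2}y^{2k+1}dy=0$. The result is the stationary phase expansion. *)

theory Defs
  imports "HOL-Analysis.Analysis"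
begin

text \<open>
  The field \<open>\<rat>(\<alpha>)\<close> as a subset of the complex numbers. Quotients with zero denominator are \<open>0\<close>
  by convention and add no elements.
\<close>

definition rat_adjoin :: "complex \<Rightarrow> complex set" where
  "rat_adjoin \<alpha> =
     {poly (map_poly of_rat p) \<alpha> / poly (map_poly of_rat q) \<alpha> | (p :: rat poly) (q :: rat poly). True}"


section \<open>Branches of polylogarithms\<close>

text \<open>
  \<open>g\<close> is, as a germ at \<open>\<gamma>(1)\<close>, the analytic continuation along the path \<open>\<gamma>\<close> of the germ of \<open>f\<close> at
  \<open>\<gamma>(0)\<close>. The function \<open>F t\<close> represents the germ at \<open>\<gamma>(t)\<close>; only its values near \<open>\<gamma>(t)\<close> matter.
\<close>

definition continuation_along ::
    "(real \<Rightarrow> complex) \<Rightarrow> (complex \<Rightarrow> complex) \<Rightarrow> (complex \<Rightarrow> complex) \<Rightarrow> bool" where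
  "continuation_along \<gamma> f g \<longleftrightarrow>
     path \<gamma> \<and>
     (\<exists>F :: real \<Rightarrow> complex \<Rightarrow> complex.
        (\<forall>t\<in>{0..1}. F t analytic_on {\<gamma> t}) \<and>
        (\<forall>t\<in>{0..1}. \<exists>\<epsilon>>0. \<forall>s\<in>{0..1}. \<bar>s - t\<bar> < \<epsilon> \<longrightarrow>
            (\<forall>\<^sub>F w in nhds (\<gamma> s). F s w = F t w)) \<and>
        (\<forall>\<^sub>F w in nhds (\<gamma> 0). F 0 w = f w) \<and>
        (\<forall>\<^sub>F w in nhds (\<gamma> 1). F 1 w = g w))"

text \<open>Only meaningful on the open unit disc; elsewhere it is used through analytic continuation.\<close>

definition polylog_series :: "int \<Rightarrow> complex \<Rightarrow> complex" where
  "polylog_series s w = (\<Sum>k. w ^ Suc k / of_nat (Suc k) powi s)"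

text \<open>
  A simultaneous choice of branches of all \<open>Li\<^sub>s\<close>, \<open>s \<in> \<int>\<close>, near \<open>p\<close>: all of them are continued along
  one common path from \<open>0\<close> to \<open>p\<close>.
\<close>

definition polylog_branch :: "complex \<Rightarrow> (int \<Rightarrow> complex \<Rightarrow> complex) \<Rightarrow> bool" where
  "polylog_branch p L \<longleftrightarrow>
     (\<exists>\<gamma>. pathstart \<gamma> = 0 \<and> pathfinish \<gamma> = p \<and>
          (\<forall>s. continuation_along \<gamma> (polylog_series s) (L s)))"


section \<open>The formal integrand\<close>

text \<open>Bernoulli polynomials by their generating function \<open>t exp(x t) / (exp(t) - 1)\<close>.\<close>

definition bernoulli_polynomial :: "nat \<Rightarrow> complex \<Rightarrow> complex" where
  "bernoulli_polynomial n x =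
     fact n * fps_nth (fps_X * fps_exp x / (fps_exp 1 - 1)) n"

text \<open>
  The coefficient of \<open>\<hbar>\<^bsup>2n-1\<^esup> Li\<^bsub>2-2n\<^esub>(- exp z)\<close> in the asymptotic expansion of
  \<open>log \<Phi>\<^sub>b(z / (2 \<pi> b))\<close>.
\<close>

definition faddeev_coeff :: "nat \<Rightarrow> complex" where
  "faddeev_coeff n = bernoulli_polynomial (2 * n) (1/2) / fact (2 * n)"

text \<open>
  \<open>V_coeff LA LB n z\<close> is the coefficient \<open>V\<^sub>n(z)\<close> of \<open>\<hbar>\<^bsup>n-1\<^esup>\<close> in
  \[ V(z,\hbar) = \sum_{j \ge 0} \hbar^{2j-1} \frac{B_{2j}(1/2)}{(2j)!}
       \Big(2 \mathrm{Li}_{2-2j}(-e^z) - \mathrm{Li}_{2-2j}(e^{-2z+\hbar/2})\Big), \]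
  where \[ \mathrm{Li}_{2-2j}(e^{-2z+\hbar/2}) =
       \sum_{k \ge 0} \mathrm{Li}_{2-2j-k}(e^{-2z}) \frac{(\hbar/2)^k}{k!}. \]
  \<open>LA\<close> and \<open>LB\<close> are the branches of the polylogarithms at the arguments \<open>- exp z\<close> and \<open>exp (- 2 z)\<close>.
\<close>

definition V_coeff ::
    "(int \<Rightarrow> complex \<Rightarrow> complex) \<Rightarrow> (int \<Rightarrow> complex \<Rightarrow> complex) \<Rightarrow> nat \<Rightarrow> complex \<Rightarrow> complex" where
  "V_coeff LA LB n z =
     (\<Sum>j\<in>{j. 2 * j = n}. faddeev_coeff j * (2 * LA (2 - 2 * int j) (- exp z))) -
     (\<Sum>(j, k)\<in>{(j, k). 2 * j + k = n}.
        faddeev_coeff j * (LB (2 - 2 * int j - int k) (exp (- 2 * z)) * (1/2) ^ k / fact k))"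

definition V_taylor ::
    "(int \<Rightarrow> complex \<Rightarrow> complex) \<Rightarrow> (int \<Rightarrow> complex \<Rightarrow> complex) \<Rightarrow> complex \<Rightarrow> nat \<Rightarrow> nat \<Rightarrow> complex" where
  "V_taylor LA LB z0 n m = (deriv ^^ m) (V_coeff LA LB n) z0 / fact m"

text \<open>
  \<open>\<alpha>\<close> is a critical point for \<open>lam'\<close>, where \<open>z0\<close> is the branch of \<open>log \<alpha>\<close> and \<open>LA\<close>, \<open>LB\<close> are branches
  of the polylogarithms for which the critical point equation holds.
\<close>

definition critical_point ::
    "int \<Rightarrow> complex \<Rightarrow> complex \<Rightarrow> (int \<Rightarrow> complex \<Rightarrow> complex) \<Rightarrow> (int \<Rightarrow> complex \<Rightarrow> complex) \<Rightarrow> bool" where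
  "critical_point lam' \<alpha> z0 LA LB \<longleftrightarrow>
     exp z0 = \<alpha> \<and> polylog_branch (- \<alpha>) LA \<and> polylog_branch (1 / \<alpha>\<^sup>2) LB \<and>
     deriv (V_coeff LA LB 0) z0 + 2 * pi * \<i> * of_int lam' = 0"


section \<open>Formal stationary phase\<close>

text \<open>
  A pair \<open>(A, S)\<close> stands for the formal expression \<open>exp(A/\<hbar>) S(t)\<close> with \<open>t = \<hbar>\<^bsup>1/2\<^esup>\<close>.
\<close>

type_synonym formal_wave = "complex \<times> complex fps"

definition wave_times :: "formal_wave \<Rightarrow> formal_wave \<Rightarrow> formal_wave"  (infixr "\<odot>" 70) where
  "wave_times W W' = (fst W + fst W', snd W * snd W')"

definition wave_exp :: "complex \<Rightarrow> formal_wave" where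
  "wave_exp A = (A, 1)"

definition wave_const :: "complex \<Rightarrow> formal_wave" where
  "wave_const a = (0, fps_const a)"

definition wave_hbar_series :: "(nat \<Rightarrow> complex) \<Rightarrow> formal_wave" where
  "wave_hbar_series c = (0, Abs_fps c oo fps_X ^ 2)"

text \<open>
  The exponent
  \[ \lambda t y + \sum_{m \ge 3} t^{m-2} y^m v_{0,m}
       + \sum_{n \ge 1, m \ge 0, (n,m) \ne (1,0)} t^{2n-2+m} y^m v_{n,m} \]
  as a power series in \<open>t\<close> with coefficients in \<open>\<complex>[y]\<close>, where \<open>\<lambda> = lam\<close>.
\<close>

definition phase_exponent :: "(nat \<Rightarrow> nat \<Rightarrow> complex) \<Rightarrow> complex \<Rightarrow> complex poly fps" where
  "phase_exponent v lam = Abs_fps (\<lambda>d.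
     (if d = 1 then monom lam 1 else 0) +
     (\<Sum>m\<in>{m. 3 \<le> m \<and> m = d + 2}. monom (v 0 m) m) +
     (\<Sum>(n, m)\<in>{(n, m). 1 \<le> n \<and> (n, m) \<noteq> (1, 0) \<and> 2 * n + m = d + 2}. monom (v n m) m))"

text \<open>
  The exponential of a series without constant term. Since \<open>E ^ r\<close> has no terms of order below \<open>r\<close>,
  the sum over \<open>r\<close> may stop at \<open>d\<close>. (The library's \<open>fps_exp\<close> is not available over \<open>\<complex>[y]\<close>.)
\<close>

definition fps_poly_exp :: "complex poly fps \<Rightarrow> complex poly fps" where
  "fps_poly_exp E = Abs_fps (\<lambda>d. \<Sum>r\<le>d. smult (1 / fact r) (fps_nth (E ^ r) d))"

text \<open>
  The formal value of the integral of \<open>exp(a y\<^sup>2) y\<^bsup>i\<^esup>\<close>; the product is the double factorial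
  \<open>(2k-1)!!\<close> for \<open>i = 2k\<close>.
\<close>

definition gauss_moment :: "complex \<Rightarrow> nat \<Rightarrow> complex" where
  "gauss_moment a i =
     (if even i
      then csqrt (of_real pi / (- a)) * (\<Prod>l<i div 2. of_nat (2 * l + 1)) / (- 2 * a) ^ (i div 2)
      else 0)"

definition gauss_integral :: "complex \<Rightarrow> complex poly \<Rightarrow> complex" where
  "gauss_integral a p = (\<Sum>i\<le>degree p. coeff p i * gauss_moment a i)"

text \<open>
  The formal expansion at \<open>z0\<close> of
  \[ \frac{\mathrm{i}}{\sqrt{2\pi \mathrm{i} \hbar}} \int
       \exp\Big(\lambda z + \frac{2\pi \mathrm{i} \lambda'}{\hbar} z + V(z,\hbar)\Big) dz \]
  obtained from \<open>z = z0 + \<hbar>\<^bsup>1/2\<^esup> y\<close>; the factor \<open>\<hbar>\<^bsup>-1/2\<^esup>\<close> cancels against \<open>dz = \<hbar>\<^bsup>1/2\<^esup> dy\<close>.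
  Here \<open>\<lambda> = lam\<close> and \<open>\<lambda>' = lam'\<close>. Square roots are principal; any other choice changes the result
  only by a sign.
\<close>

definition stationary_phase_expansion ::
    "int \<Rightarrow> int \<Rightarrow> complex \<Rightarrow> (int \<Rightarrow> complex \<Rightarrow> complex) \<Rightarrow> (int \<Rightarrow> complex \<Rightarrow> complex) \<Rightarrow> formal_wave" where
  "stationary_phase_expansion lam lam' z0 LA LB =
     (let v = V_taylor LA LB z0 in
       (v 0 0 + 2 * pi * \<i> * of_int lam' * z0,
        fps_const (\<i> * exp z0 powi lam * exp (v 1 0) / csqrt (2 * pi * \<i>)) *
        Abs_fps (\<lambda>d. gauss_integral (v 0 2)
          (fps_nth (fps_poly_exp (phase_exponent v (of_int lam))) d))))"

definition Delta :: "complex \<Rightarrow> complex" where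
  "Delta \<alpha> = - 2 * \<alpha> ^ 5 + 12 * \<alpha> ^ 3 - 2 * \<alpha>\<^sup>2 - 16 * \<alpha> - 10"

end

theory Submission
  imports Defs "HOL-Complex_Analysis.Complex_Analysis"
begin

text \<open>
  Every branch of the polylogarithms inherits, by permanence of functional relations under analytic
  continuation, the relations \<open>w Li\<^sub>s'(w) = Li\<^bsub>s-1\<^esub>(w)\<close>, \<open>exp(- Li\<^sub>1(w)) = 1 - w\<close> and
  \<open>Li\<^sub>0(w) = w/(1 - w)\<close> of the power series. Three things follow.

  The critical point equation reads \<open>2 Li\<^sub>1(-\<alpha>) + 2 Li\<^sub>1(\<alpha>\<^sup>-\<^sup>2) \<in> 2\<pi>\<i>\<int>\<close>. Exponentiating gives
  \<open>((1 + \<alpha>)(1 - \<alpha>\<^sup>-\<^sup>2))\<^sup>2 = 1\<close>, which is the sextic equation for \<open>\<alpha>\<close>, one cubic factor for each sign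
  of the square root (\<open>critical_point_algebra\<close>).

  Since \<open>V\<^sub>n\<close> is a rational combination of \<open>Li\<^bsub>2-n\<^esub>(-e\<^sup>z)\<close> and \<open>Li\<^bsub>2-n\<^esub>(e\<^bsup>-2z\<^esup>)\<close>, and each derivative in
  \<open>z\<close> lowers the index by one, the Taylor coefficient \<open>V\<^bsub>n,m\<^esub>\<close> contains only \<open>Li\<^bsub>2-n-m\<^esub>\<close>. For
  \<open>n + m \<ge> 2\<close> this is a rational function with rational coefficients: \<open>V\<^bsub>n,m\<^esub>\<close> lies in \<open>\<rat>(\<alpha>)\<close> and no
  longer depends on the branches (\<open>V_taylor_critical_V\<close>). These are exactly the coefficients that
  enter the formal Gaussian integral. The others, \<open>V\<^bsub>0,0\<^esub>\<close>, \<open>V\<^bsub>0,1\<^esub>\<close> and \<open>V\<^bsub>1,0\<^esub>\<close>, give the exponential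
  factor, the critical point equation and a square root of \<open>1 - \<alpha>\<^sup>-\<^sup>2\<close>. The latter combines with
  \<open>V\<^bsub>0,2\<^esub> = - (\<alpha>\<^sup>2 - \<alpha> + 2)/(\<alpha>\<^sup>2 - 1)\<close> from the Gaussian normalization to the prefactor
  \<open>1/sqrt(\<i> \<Delta>(\<alpha>))\<close> (\<open>prefactor_square\<close>).

  In the exponent of the formal integrand the power of \<open>y\<close> has the same parity as the power of
  \<open>t = \<hbar>\<^bsup>1/2\<^esup>\<close>. Hence odd powers of \<open>t\<close> integrate to zero (\<open>phase_expansion_odd\<close>). The variable \<open>\<lambda>\<close>
  occurs only in the term \<open>\<lambda> t y\<close>, so the coefficient of \<open>t\<^bsup>2k\<^esup>\<close> is a polynomial in \<open>\<lambda>\<close> of degree at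
  most \<open>2k\<close>, and its top coefficient is the mean of \<open>y\<^bsup>2k\<^esup>/(2k)!\<close>, which is not zero
  (\<open>degree_phase_coeff\<close>).
\<close>

section \<open>The field \<open>\<rat>(\<alpha>)\<close>\<close>

lemma poly_map_of_rat_add_mult:
  shows "poly (map_poly of_rat p) (a::complex) + poly (map_poly of_rat q) a = poly (map_poly of_rat (p + q)) a"
    and "poly (map_poly of_rat p) a * poly (map_poly of_rat q) a = poly (map_poly of_rat (p * q)) a"
proof -
  have "map_poly of_rat p + map_poly of_rat q = (map_poly of_rat (p + q) :: complex poly)"
    by (rule poly_eqI) (simp add: coeff_map_poly of_rat_add)
  then show "poly (map_poly of_rat p) a + poly (map_poly of_rat q) a = poly (map_poly of_rat (p + q)) a"
    by (metis poly_add)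
  have "map_poly of_rat p * map_poly of_rat q = (map_poly of_rat (p * q) :: complex poly)"
    by (rule poly_eqI) (simp add: coeff_map_poly coeff_mult of_rat_sum of_rat_mult)
  then show "poly (map_poly of_rat p) a * poly (map_poly of_rat q) a = poly (map_poly of_rat (p * q)) a"
    by (metis poly_mult)
qed

lemma rat_adjoin_of_rat: "of_rat r \<in> rat_adjoin a"
proof -
  have "of_rat r = poly (map_poly of_rat [:r:]) a / poly (map_poly of_rat 1) a"
    by (simp add: map_poly_pCons)
  then show ?thesis unfolding rat_adjoin_def by blast
qed

lemma rat_adjoin_0: "0 \<in> rat_adjoin a" and rat_adjoin_1: "1 \<in> rat_adjoin a"
  using rat_adjoin_of_rat[of 0] rat_adjoin_of_rat[of 1] by auto

lemma Rats_rat_adjoin: "x \<in> \<rat> \<Longrightarrow> x \<in> rat_adjoin a"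
  by (auto elim!: Rats_cases intro: rat_adjoin_of_rat)

lemma rat_adjoin_of_nat: "of_nat n \<in> rat_adjoin a"
  using rat_adjoin_of_rat[of "of_nat n"] by simp

lemma rat_adjoin_fact: "fact r \<in> rat_adjoin a"
  using rat_adjoin_of_nat[of "fact r"] by simp

lemma rat_adjoin_gen: "a \<in> rat_adjoin a"
proof -
  have "a = poly (map_poly of_rat [:0, 1:]) a / poly (map_poly of_rat 1) a"
    by (simp add: map_poly_pCons)
  then show ?thesis unfolding rat_adjoin_def by blast
qed

lemma rat_adjoin_inverse: "x \<in> rat_adjoin a \<Longrightarrow> inverse x \<in> rat_adjoin a"
  unfolding rat_adjoin_def by clarsimp (metis inverse_divide)

lemma rat_adjoin_mult: "x \<in> rat_adjoin a \<Longrightarrow> y \<in> rat_adjoin a \<Longrightarrow> x * y \<in> rat_adjoin a"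
  unfolding rat_adjoin_def by (clarsimp simp: poly_map_of_rat_add_mult) blast

lemma rat_adjoin_add:
  assumes "x \<in> rat_adjoin a" "y \<in> rat_adjoin a"
  shows "x + y \<in> rat_adjoin a"
proof (cases "x = 0 \<or> y = 0")
  case False
  obtain p q r s where x: "x = poly (map_poly of_rat p) a / poly (map_poly of_rat q) a"
    and y: "y = poly (map_poly of_rat r) a / poly (map_poly of_rat s) a"
    using assms unfolding rat_adjoin_def by blast
  \<comment> \<open>A nonzero quotient has a nonzero denominator, in spite of the convention \<open>x / 0 = 0\<close>.\<close>
  have "x + y = poly (map_poly of_rat (p * s + r * q)) a / poly (map_poly of_rat (q * s)) a"
    using False x y by (simp add: add_frac_eq flip: poly_map_of_rat_add_mult)
  then show ?thesis unfolding rat_adjoin_def by blast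
qed (use assms in auto)

lemma rat_adjoin_divide: "x \<in> rat_adjoin a \<Longrightarrow> y \<in> rat_adjoin a \<Longrightarrow> x / y \<in> rat_adjoin a"
  by (simp add: divide_inverse rat_adjoin_mult rat_adjoin_inverse)

lemma rat_adjoin_sum: "(\<And>i. i \<in> A \<Longrightarrow> f i \<in> rat_adjoin a) \<Longrightarrow> sum f A \<in> rat_adjoin a"
  by (induction A rule: infinite_finite_induct)
     (use rat_adjoin_of_rat[of 0] in \<open>auto intro: rat_adjoin_add\<close>)

lemma rat_adjoin_power: "x \<in> rat_adjoin a \<Longrightarrow> x ^ n \<in> rat_adjoin a"
  by (induction n) (use rat_adjoin_of_rat[of 1] in \<open>auto intro: rat_adjoin_mult\<close>)

lemma rat_adjoin_poly:
  "(\<And>i. coeff p i \<in> rat_adjoin a) \<Longrightarrow> x \<in> rat_adjoin a \<Longrightarrow> poly p x \<in> rat_adjoin a"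
  unfolding poly_altdef by (intro rat_adjoin_sum rat_adjoin_mult rat_adjoin_power)

section \<open>Permanence of functional relations\<close>

text \<open>
  If an operation on germs is local and preserves analyticity, then its vanishing spreads along the
  path: by the identity theorem on a small disc around \<open>\<gamma>(t)\<close>, vanishing near \<open>\<gamma>(s)\<close> is, for all \<open>s\<close>
  close to \<open>t\<close>, equivalent to vanishing on the whole disc, so \<open>[0,1]\<close> being connected does the rest.
  Permitting operations such as \<open>f \<mapsto> f'\<close> or \<open>f \<mapsto> exp(- f)\<close> covers all relations between
  polylogarithms at once. Two germs occur because a relation between \<open>Li\<^sub>s\<close> and \<open>Li\<^bsub>s-1\<^esub>\<close> connects two
  continuations, each with its own family of germs along \<open>\<gamma>\<close>.
\<close>

lemma continuation_along_permanence:
  fixes H :: "(complex \<Rightarrow> complex) \<Rightarrow> (complex \<Rightarrow> complex) \<Rightarrow> complex \<Rightarrow> complex"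
  assumes fg: "continuation_along \<gamma> f g" and hk: "continuation_along \<gamma> h k"
    and loc: "\<And>p f f' h h'. \<lbrakk>\<forall>\<^sub>F w in nhds p. f w = f' w; \<forall>\<^sub>F w in nhds p. h w = h' w\<rbrakk>
                \<Longrightarrow> \<forall>\<^sub>F w in nhds p. H f h w = H f' h' w"
    and ana: "\<And>p f h. \<lbrakk>f analytic_on {p}; h analytic_on {p}\<rbrakk> \<Longrightarrow> H f h analytic_on {p}"
    and init: "\<forall>\<^sub>F w in nhds (\<gamma> 0). H f h w = 0"
  shows "\<forall>\<^sub>F w in nhds (\<gamma> 1). H g k w = 0"
proof -
  have pth: "continuous_on {0..1} \<gamma>"
    using fg unfolding continuation_along_def path_def by blast
  obtain F where F: "\<forall>t\<in>{0..1}. F t analytic_on {\<gamma> t}"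
    and Floc: "\<forall>t\<in>{0..1}. \<exists>\<epsilon>>0. \<forall>s\<in>{0..1}. \<bar>s - t\<bar> < \<epsilon> \<longrightarrow> (\<forall>\<^sub>F w in nhds (\<gamma> s). F s w = F t w)"
    and F0: "\<forall>\<^sub>F w in nhds (\<gamma> 0). F 0 w = f w" and F1: "\<forall>\<^sub>F w in nhds (\<gamma> 1). F 1 w = g w"
    using fg unfolding continuation_along_def by blast
  obtain K where K: "\<forall>t\<in>{0..1}. K t analytic_on {\<gamma> t}"
    and Kloc: "\<forall>t\<in>{0..1}. \<exists>\<epsilon>>0. \<forall>s\<in>{0..1}. \<bar>s - t\<bar> < \<epsilon> \<longrightarrow> (\<forall>\<^sub>F w in nhds (\<gamma> s). K s w = K t w)"
    and K0: "\<forall>\<^sub>F w in nhds (\<gamma> 0). K 0 w = h w" and K1: "\<forall>\<^sub>F w in nhds (\<gamma> 1). K 1 w = k w"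
    using hk unfolding continuation_along_def by blast
  define G where "G t = H (F t) (K t)" for t
  have "\<forall>\<^sub>F w in nhds (\<gamma> 1). G 1 w = 0"
  proof (rule connected_induction_simple[where S = "{0..1::real}" and a = 0 and b = 1
          and P = "\<lambda>t. \<forall>\<^sub>F w in nhds (\<gamma> t). G t w = 0"])
    show "\<forall>\<^sub>F w in nhds (\<gamma> 0). G 0 w = 0"
      using init loc[OF F0 K0] unfolding G_def by eventually_elim simp
  next
    fix t :: real assume t: "t \<in> {0..1}"
    obtain r where r: "r > 0" "G t holomorphic_on ball (\<gamma> t) r"
      using ana[OF bspec[OF F t] bspec[OF K t]] unfolding G_def analytic_on_def by auto
    obtain e1 where e1: "e1 > 0" "\<And>s. s\<in>{0..1} \<Longrightarrow> \<bar>s - t\<bar> < e1 \<Longrightarrow> (\<forall>\<^sub>F w in nhds (\<gamma> s). F s w = F t w)"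
      using bspec[OF Floc t] by blast
    obtain e2 where e2: "e2 > 0" "\<And>s. s\<in>{0..1} \<Longrightarrow> \<bar>s - t\<bar> < e2 \<Longrightarrow> (\<forall>\<^sub>F w in nhds (\<gamma> s). K s w = K t w)"
      using bspec[OF Kloc t] by blast
    obtain e3 where e3: "e3 > 0" "\<And>s. s\<in>{0..1} \<Longrightarrow> dist s t < e3 \<Longrightarrow> dist (\<gamma> s) (\<gamma> t) < r"
      using pth[unfolded continuous_on_iff, rule_format, OF t r(1)] by blast
    define T where "T = {0..1} \<inter> ball t (min e1 (min e2 e3))"
    \<comment> \<open>The right-hand side does not mention \<open>s\<close>, so vanishing is all or nothing on \<open>T\<close>.\<close>
    have key: "(\<forall>\<^sub>F w in nhds (\<gamma> s). G s w = 0) \<longleftrightarrow> (\<forall>w\<in>ball (\<gamma> t) r. G t w = 0)" if "s \<in> T" for s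
    proof -
      have s: "s \<in> {0..1}" "\<bar>s - t\<bar> < e1" "\<bar>s - t\<bar> < e2" "dist s t < e3"
        using that unfolding T_def by (auto simp: dist_real_def)
      have mem: "\<gamma> s \<in> ball (\<gamma> t) r" using e3(2)[OF s(1,4)] by (simp add: dist_commute)
      have "\<forall>\<^sub>F w in nhds (\<gamma> s). G s w = G t w"
        unfolding G_def using loc[OF e1(2)[OF s(1,2)] e2(2)[OF s(1,3)]] .
      then have "(\<forall>\<^sub>F w in nhds (\<gamma> s). G s w = 0) \<longleftrightarrow> (\<forall>\<^sub>F w in nhds (\<gamma> s). G t w = 0)"
        by (auto elim: eventually_elim2)
      also have "\<dots> \<longleftrightarrow> (\<forall>w\<in>ball (\<gamma> t) r. G t w = 0)"
      proof
        assume "\<forall>\<^sub>F w in nhds (\<gamma> s). G t w = 0"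
        then obtain S where S: "open S" "\<gamma> s \<in> S" "\<And>w. w \<in> S \<Longrightarrow> G t w = 0"
          unfolding eventually_nhds by blast
        show "\<forall>w\<in>ball (\<gamma> t) r. G t w = 0"
        proof
          fix w assume "w \<in> ball (\<gamma> t) r"
          then show "G t w = 0"
            by (rule analytic_continuation_open[where s = "S \<inter> ball (\<gamma> t) r" and s' = "ball (\<gamma> t) r"
                  and g = "\<lambda>_. 0", rotated -1])
               (use S mem r(2) in auto)
        qed
      next
        assume "\<forall>w\<in>ball (\<gamma> t) r. G t w = 0"
        then show "\<forall>\<^sub>F w in nhds (\<gamma> s). G t w = 0"
          using mem unfolding eventually_nhds by (intro exI[of _ "ball (\<gamma> t) r"]) auto
      qed
      finally show ?thesis .
    qed
    have "openin (top_of_set {0..1}) T" unfolding T_def by (simp add: openin_open_Int)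
    moreover have "t \<in> T" using t e1 e2 e3 unfolding T_def by simp
    ultimately show "\<exists>T. openin (top_of_set {0..1}) T \<and> t \<in> T \<and>
        (\<forall>x\<in>T. \<forall>y\<in>T. (\<forall>\<^sub>F w in nhds (\<gamma> x). G x w = 0) \<longrightarrow> (\<forall>\<^sub>F w in nhds (\<gamma> y). G y w = 0))"
      using key by blast
  qed auto
  with loc[OF F1 K1] show ?thesis unfolding G_def by eventually_elim simp
qed

lemma continuation_along_analytic:
  assumes "continuation_along \<gamma> f g"
  shows "g analytic_on {\<gamma> 1}"
proof -
  obtain F where "F (1::real) analytic_on {\<gamma> 1}" and "\<forall>\<^sub>F w in nhds (\<gamma> 1). F 1 w = g w"
    using assms unfolding continuation_along_def by (metis atLeastAtMost_iff order_refl zero_le_one)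
  then show ?thesis using analytic_at_cong by blast
qed

lemma eventually_deriv_eq:
  fixes f g :: "complex \<Rightarrow> complex"
  assumes "\<forall>\<^sub>F w in nhds p. f w = g w"
  shows "\<forall>\<^sub>F w in nhds p. deriv f w = deriv g w"
proof -
  have "\<forall>\<^sub>F w in nhds p. \<forall>\<^sub>F u in nhds w. f u = g u"
    using assms by (simp add: eventually_eventually)
  then show ?thesis by (rule eventually_mono) (rule deriv_cong_ev[OF _ refl])
qed

section \<open>Branches of polylogarithms\<close>

text \<open>
  The polylogarithm as a power series indexed from \<open>0\<close>, to which termwise differentiation applies.
  The constant term is set to \<open>0\<close> separately because \<open>0 powi 0 = 1\<close>.
\<close>

definition polylog_coeff :: "int \<Rightarrow> nat \<Rightarrow> complex" where
  "polylog_coeff s n = (if n = 0 then 0 else 1 / of_nat n powi s)"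

lemma times_diffs_polylog_coeff: "w * (diffs (polylog_coeff s) n * w ^ n) = polylog_coeff (s - 1) (Suc n) * w ^ Suc n"
proof -
  have "(of_nat (Suc n) :: complex) \<noteq> 0" by (rule of_nat_neq_0)
  then show ?thesis by (simp add: diffs_def polylog_coeff_def power_int_diff field_simps del: of_nat_Suc)
qed

text \<open>
  For \<open>s \<ge> 0\<close> the coefficients are bounded by \<open>1\<close>; for negative \<open>s\<close> differentiation, which preserves
  convergence in the disc, leads from \<open>s\<close> to \<open>s - 1\<close>.
\<close>

lemma summable_polylog_coeff:
  fixes w :: complex
  assumes "norm w < 1"
  shows "summable (\<lambda>n. polylog_coeff s n * w ^ n)"
  using assms
proof (cases "0 \<le> s")
  case True
  show ?thesis
  proof (rule summable_comparison_test)
    show "\<exists>N. \<forall>n\<ge>N. norm (polylog_coeff s n * w ^ n) \<le> norm w ^ n"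
    proof (intro exI allI impI)
      fix n
      have "norm (polylog_coeff s n) \<le> 1"
      proof (cases "n = 0")
        case False
        then have "1 \<le> norm ((of_nat n :: complex) powi s)"
          using True by (simp add: norm_power_int one_le_power_int)
        with False show ?thesis by (simp add: polylog_coeff_def norm_divide divide_le_eq)
      qed (simp add: polylog_coeff_def)
      then show "norm (polylog_coeff s n * w ^ n) \<le> norm w ^ n"
        by (simp add: norm_mult norm_power mult_left_le_one_le)
    qed
    show "summable (\<lambda>n. norm w ^ n)" using assms by (simp add: summable_geometric)
  qed
next
  case False
  then have "s \<le> 0" by simp
  then show ?thesis using assms
  proof (induction arbitrary: w rule: int_le_induct)
    case (base w)
    have "(\<lambda>n. polylog_coeff 0 (Suc n) * w ^ Suc n) = (\<lambda>n. w * w ^ n)" by (simp add: polylog_coeff_def fun_eq_iff)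
    moreover have "summable (\<lambda>n. w * w ^ n)"
      using base by (intro summable_mult complete_algebra_summable_geometric)
    ultimately show ?case by (subst summable_Suc_iff[symmetric]) (simp only:)
  next
    case (step s w)
    have "summable (\<lambda>n. w * (diffs (polylog_coeff s) n * w ^ n))"
      using step.IH step.prems by (intro summable_mult termdiff_converges[of w 1]) auto
    then show ?case by (subst summable_Suc_iff[symmetric]) (simp only: times_diffs_polylog_coeff)
  qed
qed

lemma polylog_series_eq:
  assumes "norm w < 1"
  shows "polylog_series s w = (\<Sum>n. polylog_coeff s n * w ^ n)"
proof -
  have "polylog_coeff s (Suc n) * w ^ Suc n = w ^ Suc n / of_nat (Suc n) powi s" for n
    by (simp add: polylog_coeff_def)
  then show ?thesis
    using suminf_split_head[OF summable_polylog_coeff[OF assms, of s]]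
    by (simp add: polylog_series_def polylog_coeff_def del: of_nat_Suc power_Suc)
qed

lemma polylog_series_deriv:
  assumes w: "norm w < 1"
  shows "w * deriv (polylog_series s) w = polylog_series (s - 1) w"
proof -
  have "((\<lambda>w. \<Sum>n. polylog_coeff s n * w ^ n) has_field_derivative (\<Sum>n. diffs (polylog_coeff s) n * w ^ n)) (at w)"
    using summable_polylog_coeff w by (intro termdiffs_strong'[of 1]) auto
  moreover have "\<forall>\<^sub>F u in nhds w. (\<Sum>n. polylog_coeff s n * u ^ n) = polylog_series s u"
    using w polylog_series_eq by (intro eventually_nhds_in_open[of "ball 0 1", THEN eventually_mono]) auto
  ultimately have "deriv (polylog_series s) w = (\<Sum>n. diffs (polylog_coeff s) n * w ^ n)"
    by (simp add: DERIV_imp_deriv flip: deriv_cong_ev[OF _ refl])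
  then have "w * deriv (polylog_series s) w = (\<Sum>n. w * (diffs (polylog_coeff s) n * w ^ n))"
    using summable_polylog_coeff w by (subst suminf_mult) (auto intro!: termdiff_converges[of w 1])
  also have "\<dots> = (\<Sum>n. polylog_coeff (s - 1) n * w ^ n)"
    unfolding times_diffs_polylog_coeff
    using suminf_split_head[OF summable_polylog_coeff[OF w, of "s - 1"]] by (simp add: polylog_coeff_def del: of_nat_Suc power_Suc)
  finally show ?thesis by (simp add: polylog_series_eq w)
qed

lemma polylog_series_1:
  assumes w: "norm w < 1"
  shows "exp (- polylog_series 1 w) = 1 - w"
proof -
  have "(\<lambda>n. - (w ^ n / of_nat n)) sums Ln (1 - w)"
    using Ln_series'[of "- w"] w by simp
  then have "(\<lambda>n. - (polylog_coeff 1 n * w ^ n)) sums Ln (1 - w)"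
    by (rule sums_cong[THEN iffD1, rotated]) (auto simp: polylog_coeff_def)
  then have "(\<lambda>n. polylog_coeff 1 n * w ^ n) sums - Ln (1 - w)"
    using sums_minus by fastforce
  then have "polylog_series 1 w = - Ln (1 - w)"
    by (simp add: polylog_series_eq w sums_iff)
  moreover have "1 - w \<noteq> 0" using w by auto
  ultimately show ?thesis by simp
qed

lemma polylog_series_0:
  assumes w: "norm w < 1"
  shows "polylog_series 0 w * (1 - w) = w"
proof -
  have "polylog_series 0 w = w * (\<Sum>k. w ^ k)"
    using suminf_mult[OF complete_algebra_summable_geometric[OF w], of w] by (simp add: polylog_series_def)
  moreover have "1 - w \<noteq> 0" using w by auto
  ultimately show ?thesis using w by (simp add: suminf_geometric)
qed

lemma eventually_unit_disc: "(\<And>w::complex. norm w < 1 \<Longrightarrow> P w) \<Longrightarrow> \<forall>\<^sub>F w in nhds 0. P w"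
  by (rule eventually_nhds_in_open[of "ball 0 1", THEN eventually_mono]) auto

lemma polylog_branch_relation:
  assumes "polylog_branch p L"
    and loc: "\<And>p f f' h h'. \<lbrakk>\<forall>\<^sub>F w in nhds p. f w = f' w; \<forall>\<^sub>F w in nhds p. h w = h' w\<rbrakk>
                \<Longrightarrow> \<forall>\<^sub>F w in nhds p. H f h w = H f' h' w"
    and ana: "\<And>p f h. \<lbrakk>f analytic_on {p}; h analytic_on {p}\<rbrakk> \<Longrightarrow> H f h analytic_on {p}"
    and init: "\<And>w. norm w < 1 \<Longrightarrow> H (polylog_series s) (polylog_series r) w = 0"
  shows "\<forall>\<^sub>F w in nhds p. H (L s) (L r) w = 0"
proof -
  obtain \<gamma> where g: "\<gamma> 0 = 0" "\<gamma> 1 = p" "\<And>s. continuation_along \<gamma> (polylog_series s) (L s)"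
    using assms(1) unfolding polylog_branch_def pathstart_def pathfinish_def by blast
  have "\<forall>\<^sub>F w in nhds (\<gamma> 1). H (L s) (L r) w = 0"
    by (rule continuation_along_permanence[OF g(3) g(3)])
       (use loc ana init g(1) in \<open>auto intro: eventually_unit_disc\<close>)
  then show ?thesis by (simp add: g(2))
qed

lemma polylog_branch_analytic: "polylog_branch p L \<Longrightarrow> L s analytic_on {p}"
  unfolding polylog_branch_def pathfinish_def using continuation_along_analytic by blast

lemma polylog_branch_deriv:
  assumes "polylog_branch p L"
  shows "\<forall>\<^sub>F w in nhds p. w * deriv (L s) w = L (s - 1) w"
proof -
  have "\<forall>\<^sub>F w in nhds p. w * deriv (L s) w - L (s - 1) w = 0"
  proof (rule polylog_branch_relation[OF assms, where H = "\<lambda>f h w. w * deriv f w - h w"])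
    fix p and f f' h h' :: "complex \<Rightarrow> complex"
    assume "\<forall>\<^sub>F w in nhds p. f w = f' w" "\<forall>\<^sub>F w in nhds p. h w = h' w"
    from eventually_deriv_eq[OF this(1)] this(2)
    show "\<forall>\<^sub>F w in nhds p. w * deriv f w - h w = w * deriv f' w - h' w"
      by eventually_elim simp
  qed (auto intro!: analytic_intros simp: polylog_series_deriv)
  then show ?thesis by simp
qed

text \<open>
  Here \<open>Li\<^sub>1(w) = - log(1 - w)\<close>; the exponential frees the relation from the choice of the branch.
\<close>

lemma polylog_branch_exp:
  assumes "polylog_branch p L"
  shows "exp (- L 1 p) = 1 - p"
proof -
  have "\<forall>\<^sub>F w in nhds p. exp (- L 1 w) - (1 - w) = 0"
    by (rule polylog_branch_relation[OF assms, where H = "\<lambda>f h w. exp (- f w) - (1 - w)" and r = 1])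
       (auto intro!: analytic_intros simp: polylog_series_1 elim: eventually_mono)
  then show ?thesis by (auto dest: eventually_nhds_x_imp_x)
qed

lemma polylog_branch_0:
  assumes "polylog_branch p L"
  shows "\<forall>\<^sub>F w in nhds p. L 0 w * (1 - w) = w"
proof -
  have "\<forall>\<^sub>F w in nhds p. L 0 w * (1 - w) - w = 0"
    by (rule polylog_branch_relation[OF assms, where H = "\<lambda>f h w. f w * (1 - w) - w" and r = 0])
       (auto intro!: analytic_intros simp: polylog_series_0 elim: eventually_mono)
  then show ?thesis by simp
qed

text \<open>
  With \<open>u = w/(1 - w)\<close> the operator \<open>w d/dw\<close> becomes \<open>(u + u\<^sup>2) d/du\<close>, so starting from
  \<open>Li\<^sub>0(w) = u\<close> every \<open>Li\<^bsub>-s\<^esub>\<close> is a polynomial in \<open>u\<close> with integer coefficients.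
\<close>

fun polylog_poly :: "nat \<Rightarrow> complex poly" where
  "polylog_poly 0 = [:0, 1:]"
| "polylog_poly (Suc s) = pderiv (polylog_poly s) * [:0, 1, 1:]"

lemma polylog_poly_coeff: "coeff (polylog_poly s) i \<in> \<rat>"
proof (induction s arbitrary: i)
  case 0
  then show ?case by (auto simp: coeff_pCons split: nat.splits)
next
  case (Suc s)
  then show ?case
    by (auto simp: coeff_mult coeff_pderiv coeff_pCons split: nat.splits intro!: Rats_sum Rats_mult Rats_add)
qed

lemma polylog_branch_nonpos:
  assumes "polylog_branch p L"
  shows "\<forall>\<^sub>F w in nhds p. L (- int s) w = poly (polylog_poly s) (w / (1 - w))"
proof (induction s)
  case 0
  from polylog_branch_0[OF assms] show ?case
  proof eventually_elim
    case (elim w)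
    then have "w \<noteq> 1" by auto
    with elim show ?case by (simp add: field_simps)
  qed
next
  case (Suc s)
  have ev1: "\<forall>\<^sub>F w in nhds p. w \<noteq> 1"
    using polylog_branch_0[OF assms] by eventually_elim auto
  from eventually_deriv_eq[OF Suc] polylog_branch_deriv[OF assms, of "- int s"] ev1
  show ?case
  proof eventually_elim
    case (elim w)
    have "((\<lambda>w. w / (1 - w)) has_field_derivative 1 / (1 - w)\<^sup>2) (at w)"
      using elim(3) by (auto intro!: derivative_eq_intros simp: power2_eq_square field_simps)
    from DERIV_chain2[OF poly_DERIV this]
    have "deriv (\<lambda>w. poly (polylog_poly s) (w / (1 - w))) w
        = poly (pderiv (polylog_poly s)) (w / (1 - w)) * (1 / (1 - w)\<^sup>2)"
      by (rule DERIV_imp_deriv)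
    then have "w * deriv (L (- int s)) w = poly (pderiv (polylog_poly s)) (w / (1 - w)) * (w / (1 - w)\<^sup>2)"
      by (simp add: elim(1))
    moreover have "- int (Suc s) = - int s - 1" by simp
    ultimately have "L (- int (Suc s)) w = poly (pderiv (polylog_poly s)) (w / (1 - w)) * (w / (1 - w)\<^sup>2)"
      using elim(2) by metis
    also have "w / (1 - w)\<^sup>2 = poly [:0, 1, 1:] (w / (1 - w))"
      using elim(3) by (simp add: power2_eq_square field_simps)
    finally show ?case by (simp only: polylog_poly.simps poly_mult)
  qed
qed

section \<open>Rationality of the Bernoulli numbers \<open>B\<^bsub>2n\<^esub>(1/2)\<close>\<close>

lemma Rats_fact: "fact n \<in> \<rat>"
  by (metis Rats_of_nat of_nat_fact)

lemma Rats_coeff_quotient: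
  fixes D E :: "complex fps"
  assumes D: "\<And>n. fps_nth D n \<in> \<rat>" "fps_nth D 0 = 1" and E: "\<And>n. fps_nth E n \<in> \<rat>"
  shows "fps_nth (E / D) n \<in> \<rat>"
proof (induction n rule: less_induct)
  case (less n)
  have "E / D * D = E"
    using D(2) by (simp add: fps_divide_unit mult.assoc inverse_mult_eq_1)
  then have "fps_nth E n = (\<Sum>i=0..n. fps_nth (E / D) i * fps_nth D (n - i))"
    by (simp flip: fps_mult_nth)
  also have "\<dots> = (\<Sum>i<n. fps_nth (E / D) i * fps_nth D (n - i)) + fps_nth (E / D) n"
    using D(2) by (simp add: atLeast0AtMost flip: lessThan_Suc_atMost)
  finally have "fps_nth (E / D) n = fps_nth E n - (\<Sum>i<n. fps_nth (E / D) i * fps_nth D (n - i))"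
    by simp
  then show ?case using less D E by (auto intro!: Rats_diff Rats_sum Rats_mult)
qed

text \<open>
  Cancelling \<open>t\<close> makes the denominator a unit, so that the quotient obeys a recursion over \<open>\<rat>\<close>.
\<close>

lemma bernoulli_series:
  defines "D \<equiv> Abs_fps (\<lambda>n. 1 / fact (Suc n)) :: complex fps"
  shows "fps_X * fps_exp x / (fps_exp 1 - 1) = fps_exp x / D"
proof -
  have "fps_exp 1 - 1 = fps_X * D"
  proof (rule fps_ext)
    show "fps_nth (fps_exp 1 - 1) n = fps_nth (fps_X * D) n" for n
      by (cases n) (auto simp: D_def distrib_right)
  qed
  moreover have "D \<noteq> 0" by (auto simp: D_def fps_eq_iff intro!: exI[of _ 0])
  ultimately show ?thesis by (simp add: fps_divide_times_eq)
qed

lemma faddeev_coeff_Rats: "faddeev_coeff n \<in> \<rat>"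
proof -
  have "fps_nth (fps_exp (1/2 :: complex) / Abs_fps (\<lambda>n. 1 / fact (Suc n))) m \<in> \<rat>" for m
    by (rule Rats_coeff_quotient) (auto simp: fps_exp_def intro!: Rats_divide Rats_power Rats_fact simp del: fact_Suc)
  then show ?thesis
    unfolding faddeev_coeff_def bernoulli_polynomial_def bernoulli_series by simp
qed

lemma faddeev_coeff_0: "faddeev_coeff 0 = 1"
  unfolding faddeev_coeff_def bernoulli_polynomial_def bernoulli_series
  by (simp add: fps_divide_unit)

section \<open>Taylor coefficients of \<open>V\<^sub>n\<close>\<close>

definition V_weightA :: "nat \<Rightarrow> complex" where
  "V_weightA n = (if even n then 2 * faddeev_coeff (n div 2) else 0)"

definition V_weightB :: "nat \<Rightarrow> complex" where
  "V_weightB n = (\<Sum>(j, k)\<in>{(j, k). 2 * j + k = n}. faddeev_coeff j * (1/2) ^ k / fact k)"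

text \<open>
  All terms of \<open>V\<^sub>n\<close> with the same argument involve the same polylogarithm: if \<open>2j + k = n\<close> then
  \<open>2 - 2j - k = 2 - n\<close>.
\<close>

lemma V_coeff_eq:
  "V_coeff LA LB n z =
     V_weightA n * LA (2 - int n) (- exp z) - V_weightB n * LB (2 - int n) (exp (- 2 * z))"
proof -
  have "{j. 2 * j = n} = (if even n then {n div 2} else {})" by auto
  then have "(\<Sum>j\<in>{j. 2 * j = n}. faddeev_coeff j * (2 * LA (2 - 2 * int j) (- exp z)))
      = V_weightA n * LA (2 - int n) (- exp z)"
    by (auto simp: V_weightA_def elim!: evenE)
  moreover have "(\<Sum>(j, k)\<in>{(j, k). 2 * j + k = n}.
        faddeev_coeff j * (LB (2 - 2 * int j - int k) (exp (- 2 * z)) * (1/2) ^ k / fact k))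
      = V_weightB n * LB (2 - int n) (exp (- 2 * z))"
    unfolding V_weightB_def sum_distrib_right
    by (intro sum.cong refl) (auto simp: algebra_simps)
  ultimately show ?thesis unfolding V_coeff_def by simp
qed

lemma V_weight_Rats: "V_weightA n \<in> \<rat>" "V_weightB n \<in> \<rat>"
  unfolding V_weightA_def V_weightB_def
  by (auto intro!: Rats_mult Rats_sum Rats_divide Rats_power Rats_fact faddeev_coeff_Rats)

lemma V_weight_values: "V_weightA 0 = 2" "V_weightB 0 = 1" "V_weightA 1 = 0" "V_weightB 1 = 1/2"
proof -
  have "{(j, k). 2 * j + k = 0} = {(0, 0 :: nat)}" "{(j, k). 2 * j + k = 1} = {(0, 1 :: nat)}"
    by (auto, presburger+)
  then show "V_weightA 0 = 2" "V_weightB 0 = 1" "V_weightA 1 = 0" "V_weightB 1 = 1/2"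
    unfolding V_weightA_def V_weightB_def by (simp_all add: faddeev_coeff_0)
qed

lemma exp_minus_double: "exp (- 2 * z) = 1 / (exp z)\<^sup>2" for z :: complex
  by (simp add: exp_minus exp_double inverse_eq_divide)

text \<open>
  The substitution \<open>w = k e\<^bsup>cz\<^esup>\<close> turns \<open>w d/dw\<close> into \<open>c\<^sup>-\<^sup>1 d/dz\<close>. It covers both arguments, \<open>- e\<^sup>z\<close>
  and \<open>e\<^bsup>-2z\<^esup>\<close>.
\<close>

lemma polylog_branch_exp_chain:
  assumes L: "polylog_branch (k * exp (c * z0)) L"
  shows "\<forall>\<^sub>F z in nhds z0. ((\<lambda>z. L s (k * exp (c * z))) has_field_derivative
           c * L (s - 1) (k * exp (c * z))) (at z)"
proof -
  obtain S where S: "open S" "k * exp (c * z0) \<in> S" "L s holomorphic_on S"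
    using polylog_branch_analytic[OF L, of s] unfolding analytic_at by blast
  have "\<forall>\<^sub>F w in nhds (k * exp (c * z0)). w \<in> S \<and> w * deriv (L s) w = L (s - 1) w"
    using eventually_nhds_in_open[OF S(1,2)] polylog_branch_deriv[OF L] by (rule eventually_conj)
  moreover have "filterlim (\<lambda>z. k * exp (c * z)) (nhds (k * exp (c * z0))) (nhds z0)"
    by (intro tendsto_intros filterlim_ident)
  ultimately have "\<forall>\<^sub>F z in nhds z0. k * exp (c * z) \<in> S \<and>
      k * exp (c * z) * deriv (L s) (k * exp (c * z)) = L (s - 1) (k * exp (c * z))"
    by (rule eventually_compose_filterlim)
  then show ?thesis
  proof eventually_elim
    case (elim z)
    have "(L s has_field_derivative deriv (L s) (k * exp (c * z))) (at (k * exp (c * z)))"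
      using elim S by (auto intro: holomorphic_derivI)
    moreover have "((\<lambda>z. k * exp (c * z)) has_field_derivative c * (k * exp (c * z))) (at z)"
      by (auto intro!: derivative_eq_intros)
    ultimately have "((\<lambda>z. L s (k * exp (c * z))) has_field_derivative
        deriv (L s) (k * exp (c * z)) * (c * (k * exp (c * z)))) (at z)"
      by (rule DERIV_chain2)
    also have "deriv (L s) (k * exp (c * z)) * (c * (k * exp (c * z))) = c * L (s - 1) (k * exp (c * z))"
      using elim by (simp add: mult_ac)
    finally show ?case .
  qed
qed

lemma V_coeff_higher_deriv:
  assumes LA: "polylog_branch (- exp z0) LA" and LB: "polylog_branch (exp (- 2 * z0)) LB"
  shows "\<forall>\<^sub>F z in nhds z0. (deriv ^^ m) (V_coeff LA LB n) z =
     V_weightA n * LA (2 - int (n + m)) (- exp z) -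
     V_weightB n * (- 2) ^ m * LB (2 - int (n + m)) (exp (- 2 * z))"
proof (induction m)
  case 0
  then show ?case by (simp add: V_coeff_eq)
next
  case (Suc m)
  have dA: "\<forall>\<^sub>F z in nhds z0. ((\<lambda>z. LA s (- exp z)) has_field_derivative LA (s - 1) (- exp z)) (at z)" for s
    using polylog_branch_exp_chain[of "- 1" 1 z0 LA s] LA by simp
  have dB: "\<forall>\<^sub>F z in nhds z0. ((\<lambda>z. LB s (exp (- 2 * z))) has_field_derivative
      - 2 * LB (s - 1) (exp (- 2 * z))) (at z)" for s
    using polylog_branch_exp_chain[of 1 "- 2" z0 LB s] LB by simp
  from eventually_deriv_eq[OF Suc] dA[of "2 - int (n + m)"] dB[of "2 - int (n + m)"]
  show ?case
  proof eventually_elim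
    case (elim z)
    have "deriv (\<lambda>z. V_weightA n * LA (2 - int (n + m)) (- exp z) -
            V_weightB n * (- 2) ^ m * LB (2 - int (n + m)) (exp (- 2 * z))) z
        = V_weightA n * LA (2 - int (n + m) - 1) (- exp z) -
            V_weightB n * (- 2) ^ m * (- 2 * LB (2 - int (n + m) - 1) (exp (- 2 * z)))"
      by (intro DERIV_imp_deriv DERIV_diff DERIV_cmult elim(2,3))
    moreover have "2 - int (n + m) - 1 = 2 - int (n + Suc m)" by simp
    ultimately show ?case using elim(1) by (simp only: funpow.simps o_apply power_Suc mult_ac)
  qed
qed

lemma V_taylor_eq:
  assumes LA: "polylog_branch (- exp z0) LA" and LB: "polylog_branch (exp (- 2 * z0)) LB"
  shows "V_taylor LA LB z0 n m =
     (V_weightA n * LA (2 - int (n + m)) (- exp z0) -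
      V_weightB n * (- 2) ^ m * LB (2 - int (n + m)) (exp (- 2 * z0))) / fact m"
  unfolding V_taylor_def using eventually_nhds_x_imp_x[OF V_coeff_higher_deriv[OF LA LB]] by simp

text \<open>
  The value of \<open>V\<^bsub>n,m\<^esub>\<close> at a critical point for \<open>n + m \<ge> 2\<close>, in terms of \<open>\<alpha>\<close> alone: the arguments
  are \<open>w/(1 - w)\<close> for \<open>w = - \<alpha>\<close> and \<open>w = \<alpha>\<^sup>-\<^sup>2\<close>. For \<open>n + m < 2\<close> the truncated subtraction gives it a
  value without meaning.
\<close>

definition critical_V :: "complex \<Rightarrow> nat \<Rightarrow> nat \<Rightarrow> complex" where
  "critical_V \<alpha> n m =
     (V_weightA n * poly (polylog_poly (n + m - 2)) (- \<alpha> / (1 + \<alpha>)) -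
      V_weightB n * (- 2) ^ m * poly (polylog_poly (n + m - 2)) (1 / (\<alpha>\<^sup>2 - 1))) / fact m"

lemma V_taylor_critical_V:
  assumes LA: "polylog_branch (- exp z0) LA" and LB: "polylog_branch (exp (- 2 * z0)) LB"
    and nm: "2 \<le> n + m"
  shows "V_taylor LA LB z0 n m = critical_V (exp z0) n m"
proof -
  have s: "2 - int (n + m) = - int (n + m - 2)" using nm by simp
  note uB = exp_minus_double[of z0]
  have "exp (- 2 * z0) / (1 - exp (- 2 * z0)) = 1 / ((exp z0)\<^sup>2 - 1)"
    unfolding uB by (simp add: divide_simps)
  then show ?thesis
    unfolding V_taylor_eq[OF LA LB] critical_V_def s
    using eventually_nhds_x_imp_x[OF polylog_branch_nonpos[OF LA]]
      eventually_nhds_x_imp_x[OF polylog_branch_nonpos[OF LB]]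
    by simp
qed

lemma critical_V_rat_adjoin: "critical_V \<alpha> n m \<in> rat_adjoin \<alpha>"
proof -
  have neg: "- x \<in> rat_adjoin \<alpha>" if "x \<in> rat_adjoin \<alpha>" for x
    using rat_adjoin_mult[OF rat_adjoin_of_rat[of "- 1"] that] by (simp add: of_rat_minus)
  have diff: "x - y \<in> rat_adjoin \<alpha>" if "x \<in> rat_adjoin \<alpha>" "y \<in> rat_adjoin \<alpha>" for x y
    using rat_adjoin_add[OF that(1) neg[OF that(2)]] by simp
  have two: "2 \<in> rat_adjoin \<alpha>" by (rule Rats_rat_adjoin) simp
  show ?thesis unfolding critical_V_def
    by (intro rat_adjoin_divide rat_adjoin_fact diff neg two rat_adjoin_mult rat_adjoin_poly
        rat_adjoin_add rat_adjoin_1 rat_adjoin_power rat_adjoin_gen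
        Rats_rat_adjoin[OF polylog_poly_coeff] Rats_rat_adjoin[OF V_weight_Rats(1)]
        Rats_rat_adjoin[OF V_weight_Rats(2)])
qed

section \<open>Critical points\<close>

lemma critical_point_branches:
  assumes "critical_point lam' \<alpha> z0 LA LB"
  shows "\<alpha> = exp z0" "polylog_branch (- exp z0) LA" "polylog_branch (exp (- 2 * z0)) LB"
    "exp (- 2 * z0) = 1 / \<alpha>\<^sup>2" "\<alpha> \<noteq> 0"
proof -
  show "\<alpha> = exp z0" and "exp (- 2 * z0) = 1 / \<alpha>\<^sup>2" and "\<alpha> \<noteq> 0"
    using assms unfolding critical_point_def exp_minus_double by auto
  then show "polylog_branch (- exp z0) LA" "polylog_branch (exp (- 2 * z0)) LB"
    using assms unfolding critical_point_def by simp_all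
qed

text \<open>
  The exponential of the critical point equation: it turns \<open>Li\<^sub>1\<close> into \<open>- log(1 - w)\<close> and removes
  both the choice of branches and \<open>\<lambda>'\<close>.
\<close>

lemma critical_point_equation:
  assumes "critical_point lam' \<alpha> z0 LA LB"
  shows "((1 + \<alpha>) * (1 - 1 / \<alpha>\<^sup>2))\<^sup>2 = 1"
proof -
  note b = critical_point_branches[OF assms]
  have "deriv (V_coeff LA LB 0) z0 = 2 * LA 1 (- \<alpha>) + 2 * LB 1 (1 / \<alpha>\<^sup>2)"
    using eventually_nhds_x_imp_x[OF V_coeff_higher_deriv[OF b(2,3), of 1 0]] b(1,4)
    by (simp add: V_weight_values)
  then have "2 * LA 1 (- \<alpha>) + 2 * LB 1 (1 / \<alpha>\<^sup>2) + 2 * of_real pi * \<i> * of_int lam' = 0"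
    using assms unfolding critical_point_def by simp
  then have eq: "2 * (- LA 1 (- \<alpha>)) + 2 * (- LB 1 (1 / \<alpha>\<^sup>2)) = 2 * of_int lam' * of_real pi * \<i>"
    by algebra
  have "exp (- LA 1 (- \<alpha>)) = 1 + \<alpha>" "exp (- LB 1 (1 / \<alpha>\<^sup>2)) = 1 - 1 / \<alpha>\<^sup>2"
    using polylog_branch_exp[OF b(2)] polylog_branch_exp[OF b(3)] b(1,4) by simp_all
  then have "((1 + \<alpha>) * (1 - 1 / \<alpha>\<^sup>2))\<^sup>2 = exp (2 * (- LA 1 (- \<alpha>)) + 2 * (- LB 1 (1 / \<alpha>\<^sup>2)))"
    by (simp only: exp_add exp_double power_mult_distrib)
  also have "\<dots> = 1" unfolding eq using exp_integer_2pi[of "of_int lam'"] by simp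
  finally show ?thesis .
qed

text \<open>
  Clearing denominators gives \<open>((1 + \<alpha>)(\<alpha>\<^sup>2 - 1))\<^sup>2 = \<alpha>\<^sup>4\<close>, a difference of two squares. The quadratic
  \<open>\<alpha>\<^sup>2 - \<alpha> + 2\<close>, the numerator of \<open>V\<^bsub>0,2\<^esub>\<close>, is coprime to both cubic factors, so the critical points
  are nondegenerate. The formula for \<open>\<Delta>\<close> is the form in which it arises from stationary phase; it
  agrees with the polynomial only modulo the sextic equation.
\<close>

lemma critical_point_algebra:
  fixes \<alpha> :: complex
  assumes nz: "\<alpha> \<noteq> 0" and eq: "((1 + \<alpha>) * (1 - 1 / \<alpha>\<^sup>2))\<^sup>2 = 1"
  shows "(\<alpha> ^ 3 - \<alpha> - 1) * (\<alpha> ^ 3 + 2 * \<alpha>\<^sup>2 - \<alpha> - 1) = 0"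
    and "\<alpha>\<^sup>2 \<noteq> 1" and "\<alpha>\<^sup>2 - \<alpha> + 2 \<noteq> 0"
    and "Delta \<alpha> = - 2 * \<alpha>\<^sup>2 * (\<alpha>\<^sup>2 - \<alpha> + 2) / (\<alpha>\<^sup>2 - 1)\<^sup>2"
proof -
  have "((1 + \<alpha>) * (\<alpha>\<^sup>2 - 1))\<^sup>2 = (\<alpha>\<^sup>2)\<^sup>2 * ((1 + \<alpha>) * (1 - 1 / \<alpha>\<^sup>2))\<^sup>2"
    using nz by (simp add: field_simps power2_eq_square)
  then have sq: "((1 + \<alpha>) * (\<alpha>\<^sup>2 - 1))\<^sup>2 = (\<alpha>\<^sup>2)\<^sup>2" using eq by simp
  show fac: "(\<alpha> ^ 3 - \<alpha> - 1) * (\<alpha> ^ 3 + 2 * \<alpha>\<^sup>2 - \<alpha> - 1) = 0"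
    using sq by algebra
  show ne: "\<alpha>\<^sup>2 \<noteq> 1" using sq nz by auto
  show "\<alpha>\<^sup>2 - \<alpha> + 2 \<noteq> 0"
  proof
    assume "\<alpha>\<^sup>2 - \<alpha> + 2 = 0"
    \<comment> \<open>Modulo the quadratic the two cubics are \<open>- (2\<alpha> + 3)\<close> and \<open>- 7\<close>.\<close>
    with fac have "7 * (2 * \<alpha> + 3) = 0" by algebra
    then have "2 * \<alpha> + 3 = 0" by (simp only: mult_eq_0_iff) simp
    with \<open>\<alpha>\<^sup>2 - \<alpha> + 2 = 0\<close> have "(23 :: complex) = 0" by algebra
    then show False by simp
  qed
  have "Delta \<alpha> * (\<alpha>\<^sup>2 - 1)\<^sup>2 = - 2 * \<alpha>\<^sup>2 * (\<alpha>\<^sup>2 - \<alpha> + 2)"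
    unfolding Delta_def using fac by algebra
  then show "Delta \<alpha> = - 2 * \<alpha>\<^sup>2 * (\<alpha>\<^sup>2 - \<alpha> + 2) / (\<alpha>\<^sup>2 - 1)\<^sup>2"
    by (rule eq_divide_imp[rotated]) (use ne in simp)
qed

lemma critical_V_02:
  assumes "\<alpha>\<^sup>2 \<noteq> 1"
  shows "critical_V \<alpha> 0 2 = - (\<alpha>\<^sup>2 - \<alpha> + 2) / (\<alpha>\<^sup>2 - 1)"
proof -
  have *: "1 + \<alpha> \<noteq> 0"
  proof
    assume "1 + \<alpha> = 0"
    then have "\<alpha> = - 1" by (simp add: eq_neg_iff_add_eq_0 add.commute)
    with assms show False by simp
  qed
  have **: "\<alpha>\<^sup>2 - 1 = (\<alpha> - 1) * (1 + \<alpha>)" by (simp add: power2_eq_square algebra_simps)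
  have ***: "\<alpha> - 1 \<noteq> 0" using assms by auto
  have "critical_V \<alpha> 0 2 = - \<alpha> / (1 + \<alpha>) - 2 / (\<alpha>\<^sup>2 - 1)"
    by (simp add: critical_V_def V_weight_values)
  also have "\<dots> = - (\<alpha>\<^sup>2 - \<alpha> + 2) / (\<alpha>\<^sup>2 - 1)"
    unfolding ** using * *** by (simp add: divide_simps) (simp add: power2_eq_square algebra_simps)
  finally show ?thesis .
qed

text \<open>
  A product of principal square roots need not be principal, so only the square has a closed form;
  the sign is absorbed by the choice of \<open>sqrt(\<i> \<Delta>(\<alpha>))\<close>.
\<close>

lemma prefactor_square:
  assumes cp: "critical_point lam' \<alpha> z0 LA LB"
  shows "(\<i> * exp (V_taylor LA LB z0 1 0) / csqrt (2 * pi * \<i>) * csqrt (of_real pi / (- critical_V \<alpha> 0 2)))\<^sup>2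
    = inverse (\<i> * Delta \<alpha>)"
proof -
  note b = critical_point_branches[OF cp]
  note alg = critical_point_algebra[OF b(5) critical_point_equation[OF cp]]
  have "V_taylor LA LB z0 1 0 = - LB 1 (1 / \<alpha>\<^sup>2) / 2"
    unfolding V_taylor_eq[OF b(2,3)] using b(4) V_weight_values by simp
  then have "(exp (V_taylor LA LB z0 1 0))\<^sup>2 = exp (- LB 1 (1 / \<alpha>\<^sup>2))"
    by (simp flip: exp_double)
  also have "\<dots> = 1 - 1 / \<alpha>\<^sup>2" using polylog_branch_exp[OF b(3)] b(4) by simp
  finally have E: "(exp (V_taylor LA LB z0 1 0))\<^sup>2 = (\<alpha>\<^sup>2 - 1) / \<alpha>\<^sup>2"
    using b(5) by (simp add: field_simps)
  have sq: "(\<i> * e / s * m)\<^sup>2 = - e\<^sup>2 / s\<^sup>2 * m\<^sup>2" for e s m :: complex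
    by (simp add: power_mult_distrib power_divide)
  have "- (r / A) / (2 * P * \<i>) * (P / (- (- q / r))) = inverse (\<i> * (- 2 * A * q / r\<^sup>2))"
    if "r \<noteq> 0" "A \<noteq> 0" "P \<noteq> 0" "q \<noteq> 0" for r A P q :: complex
    using that by (simp add: divide_simps power2_eq_square)
  from this[of "\<alpha>\<^sup>2 - 1" "\<alpha>\<^sup>2" "of_real pi" "\<alpha>\<^sup>2 - \<alpha> + 2"] show ?thesis
    unfolding sq power2_csqrt E alg(4) critical_V_02[OF alg(2)] using alg(2,3) b(5) by simp
qed

section \<open>The exponential of the phase\<close>

text \<open>
  Series \<open>\<Sum> c\<^bsub>d,i\<^esub> t\<^sup>d y\<^sup>i\<close> with coefficients in \<open>K\<close> that are invariant under \<open>(t, y) \<mapsto> (-t, -y)\<close>.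
  Combining the two conditions lets one induction serve both the vanishing of half-integral powers
  of \<open>\<hbar>\<close> and the rationality of the remaining ones.
\<close>

definition graded_fps :: "complex set \<Rightarrow> complex poly fps \<Rightarrow> bool" where
  "graded_fps K F \<longleftrightarrow> (\<forall>d i. coeff (fps_nth F d) i \<in> (if even (d + i) then K else {0}))"

lemma graded_fps_odd: "graded_fps K F \<Longrightarrow> odd (d + i) \<Longrightarrow> coeff (fps_nth F d) i = 0"
  unfolding graded_fps_def by (drule spec[of _ d], drule spec[of _ i]) simp

lemma graded_fps_coeff: "graded_fps (rat_adjoin a) F \<Longrightarrow> coeff (fps_nth F d) i \<in> rat_adjoin a"
  unfolding graded_fps_def
  by (drule spec[of _ d], drule spec[of _ i]) (simp add: rat_adjoin_0 split: if_splits)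

lemma graded_fps_1: "graded_fps (rat_adjoin a) 1"
  unfolding graded_fps_def by (auto simp: fps_one_nth coeff_1 rat_adjoin_0 rat_adjoin_1)

lemma graded_fps_mult:
  assumes F: "graded_fps (rat_adjoin a) F" and G: "graded_fps (rat_adjoin a) G"
  shows "graded_fps (rat_adjoin a) (F * G)"
  unfolding graded_fps_def
proof (intro allI)
  fix d i
  have eq: "coeff (fps_nth (F * G) d) i
      = (\<Sum>e=0..d. \<Sum>j\<le>i. coeff (fps_nth F e) j * coeff (fps_nth G (d - e)) (i - j))"
    by (simp add: fps_mult_nth coeff_sum coeff_mult)
  have K: "coeff (fps_nth F e) j \<in> rat_adjoin a" "coeff (fps_nth G e) j \<in> rat_adjoin a" for e j
    using graded_fps_coeff F G by blast+
  show "coeff (fps_nth (F * G) d) i \<in> (if even (d + i) then rat_adjoin a else {0})"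
  proof (cases "even (d + i)")
    case True
    then show ?thesis unfolding eq using K by (auto intro!: rat_adjoin_sum rat_adjoin_mult)
  next
    case False
    have "coeff (fps_nth F e) j * coeff (fps_nth G (d - e)) (i - j) = 0" if "e \<le> d" "j \<le> i" for e j
    proof -
      have "d + i = (e + j) + ((d - e) + (i - j))" using that by simp
      then have "odd (e + j) \<or> odd ((d - e) + (i - j))" using False by (metis even_add)
      then show ?thesis
      proof
        assume "odd (e + j)"
        from graded_fps_odd[OF F this] show ?thesis by simp
      next
        assume "odd ((d - e) + (i - j))"
        from graded_fps_odd[OF G this] show ?thesis by simp
      qed
    qed
    then show ?thesis unfolding eq using False by (simp add: sum.neutral)
  qed
qed

lemma graded_fps_power: "graded_fps (rat_adjoin a) F \<Longrightarrow> graded_fps (rat_adjoin a) (F ^ r)"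
  by (induction r) (auto intro: graded_fps_1 graded_fps_mult)

lemma graded_fps_poly_exp:
  assumes "graded_fps (rat_adjoin a) F"
  shows "graded_fps (rat_adjoin a) (fps_poly_exp F)"
  unfolding graded_fps_def
proof (intro allI)
  fix d i
  have "coeff (fps_nth (F ^ r) d) i \<in> (if even (d + i) then rat_adjoin a else {0})" for r
    using graded_fps_power[OF assms] unfolding graded_fps_def by blast
  then show "coeff (fps_nth (fps_poly_exp F) d) i \<in> (if even (d + i) then rat_adjoin a else {0})"
    by (auto simp: fps_poly_exp_def coeff_sum split: if_splits
        intro!: rat_adjoin_sum rat_adjoin_divide rat_adjoin_fact sum.neutral)
qed

text \<open>
  The monomials are \<open>t\<^bsup>2n-2+m\<^esup> y\<^sup>m\<close>, and they all satisfy \<open>n + m \<ge> 2\<close>.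
\<close>

lemma graded_phase_exponent:
  assumes "\<And>n m. 2 \<le> n + m \<Longrightarrow> v n m \<in> rat_adjoin a"
  shows "graded_fps (rat_adjoin a) (phase_exponent v 0)"
  unfolding graded_fps_def
proof (intro allI)
  fix d i
  show "coeff (fps_nth (phase_exponent v 0) d) i \<in> (if even (d + i) then rat_adjoin a else {0})"
  proof (cases "even (d + i)")
    case True
    then show ?thesis using assms
      by (auto simp: phase_exponent_def coeff_sum case_prod_beta rat_adjoin_0
          intro!: rat_adjoin_add rat_adjoin_sum)
  next
    case False
    have "(\<Sum>m\<in>{m. 3 \<le> m \<and> m = d + 2}. coeff (monom (v 0 m) m) i) = 0"
      by (rule sum.neutral) (use False in auto)
    moreover have "(\<Sum>(n, m)\<in>{(n, m). 1 \<le> n \<and> (n, m) \<noteq> (1, 0) \<and> 2 * n + m = d + 2}. coeff (monom (v n m) m) i) = 0"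
    proof (rule sum.neutral, rule ballI)
      fix x :: "nat \<times> nat" assume "x \<in> {(n, m). 1 \<le> n \<and> (n, m) \<noteq> (1, 0) \<and> 2 * n + m = d + 2}"
      then obtain n m where x: "x = (n, m)" "2 * n + m = d + 2" by auto
      then have "even m \<longleftrightarrow> even d" by presburger
      then show "(case x of (n, m) \<Rightarrow> coeff (monom (v n m) m) i) = 0" using False x by auto
    qed
    ultimately show ?thesis using False
      by (simp add: phase_exponent_def coeff_sum case_prod_beta)
  qed
qed

lemma phase_exponent_split: "phase_exponent v lam = fps_const (monom lam 1) * fps_X + phase_exponent v 0"
  by (rule fps_ext) (auto simp: phase_exponent_def)

lemma phase_exponent_cong:
  assumes "\<And>n m. 2 \<le> n + m \<Longrightarrow> v n m = v' n m"
  shows "phase_exponent v lam = phase_exponent v' lam"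
  unfolding phase_exponent_def using assms
  by (intro arg_cong[of _ _ Abs_fps] ext arg_cong2[of _ _ _ _ "(+)"] sum.cong) auto

lemma smult_sum_right: "smult c (\<Sum>x\<in>A. f x) = (\<Sum>x\<in>A. smult c (f x))"
  by (induction A rule: infinite_finite_induct) (auto simp: smult_add_right)

text \<open>
  This is \<open>exp(p t + F) = exp(p t) exp(F)\<close>, read off at \<open>t\<^sup>d\<close>; for \<open>p = \<lambda> y\<close> it isolates the whole
  dependence on \<open>\<lambda>\<close>. The truncation of the exponential series at order \<open>d\<close> is compatible with the
  product because splitting off \<open>(p t)\<^sup>j\<close> from the power \<open>(p t + F)\<^sup>r\<close> lowers both the exponent \<open>r\<close>
  and the order \<open>d\<close> by \<open>j\<close>.
\<close>

lemma fps_poly_exp_linear_term: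
  "fps_nth (fps_poly_exp (fps_const p * fps_X + F)) d =
     (\<Sum>j\<le>d. smult (1 / fact j) (p ^ j * fps_nth (fps_poly_exp F) (d - j)))"
proof -
  define g where "g j s = smult (1 / fact j) (p ^ j * smult (1 / fact s) (fps_nth (F ^ s) (d - j)))" for j s
  have power_nth: "smult (1 / fact r) (fps_nth ((fps_const p * fps_X + F) ^ r) d) = (\<Sum>j\<le>r. g j (r - j))"
    if "r \<le> d" for r
  proof -
    have "fps_nth ((fps_const p * fps_X + F) ^ r) d
        = (\<Sum>j\<le>r. fps_nth (of_nat (r choose j) * (fps_const p * fps_X) ^ j * F ^ (r - j)) d)"
      by (simp add: binomial_ring fps_sum_nth)
    also have "\<dots> = (\<Sum>j\<le>r. of_nat (r choose j) * (p ^ j * fps_nth (F ^ (r - j)) (d - j)))"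
    proof (rule sum.cong[OF refl])
      fix j assume "j \<in> {..r}"
      then have "j \<le> d" using that by simp
      have eq: "of_nat (r choose j) * (fps_const p * fps_X) ^ j * F ^ (r - j)
          = fps_const (of_nat (r choose j) * p ^ j) * (fps_X ^ j * F ^ (r - j))"
        by (simp add: power_mult_distrib fps_const_power fps_of_nat[symmetric] mult_ac flip: fps_const_mult)
      show "fps_nth (of_nat (r choose j) * (fps_const p * fps_X) ^ j * F ^ (r - j)) d
          = of_nat (r choose j) * (p ^ j * fps_nth (F ^ (r - j)) (d - j))"
        unfolding eq fps_mult_left_const_nth fps_X_power_mult_nth
        using \<open>j \<le> d\<close> by (simp add: mult.assoc)
    qed
    also have "smult (1 / fact r) \<dots> = (\<Sum>j\<le>r. g j (r - j))"
      unfolding smult_sum_right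
    proof (rule sum.cong[OF refl])
      fix j assume "j \<in> {..r}"
      then have "(of_nat (r choose j) :: complex) / fact r = 1 / (fact j * fact (r - j))"
        by (simp add: binomial_fact)
      then show "smult (1 / fact r) (of_nat (r choose j) * (p ^ j * fps_nth (F ^ (r - j)) (d - j))) = g j (r - j)"
        by (simp add: g_def of_nat_poly)
    qed
    finally show ?thesis .
  qed
  have "fps_nth (fps_poly_exp (fps_const p * fps_X + F)) d = (\<Sum>r\<le>d. \<Sum>j\<le>r. g j (r - j))"
    using power_nth by (simp add: fps_poly_exp_def)
  also have "\<dots> = (\<Sum>(j, s)\<in>{(j, s). j + s \<le> d}. g j s)"
    by (rule sum.triangle_reindex_eq[symmetric])
  also have "{(j, s). j + s \<le> d} = (SIGMA j:{..d}. {..d - j})" by auto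
  also have "(\<Sum>(j, s)\<in>(SIGMA j:{..d}. {..d - j}). g j s) = (\<Sum>j\<le>d. \<Sum>s\<le>d - j. g j s)"
    by (rule sum.Sigma[symmetric]) auto
  also have "\<dots> = (\<Sum>j\<le>d. smult (1 / fact j) (p ^ j * fps_nth (fps_poly_exp F) (d - j)))"
    by (simp add: g_def fps_poly_exp_def smult_sum_right sum_distrib_left)
  finally show ?thesis .
qed

section \<open>Formal Gaussian integration\<close>

text \<open>
  The formal Gaussian integral normalized to total mass \<open>1\<close>, which removes the square root and is
  therefore rational in \<open>a\<close> and the coefficients of \<open>p\<close>.
\<close>

definition gauss_mean :: "complex \<Rightarrow> complex poly \<Rightarrow> complex" where
  "gauss_mean a p = (\<Sum>i\<le>degree p. coeff p i *
     (if even i then (\<Prod>l<i div 2. of_nat (2 * l + 1)) / (- 2 * a) ^ (i div 2) else 0))"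

lemma gauss_integral_eq: "gauss_integral a p = csqrt (of_real pi / (- a)) * gauss_mean a p"
  unfolding gauss_integral_def gauss_mean_def gauss_moment_def sum_distrib_left
  by (intro sum.cong) auto

lemma gauss_mean_superset:
  assumes "degree p \<le> N"
  shows "gauss_mean a p = (\<Sum>i\<le>N. coeff p i *
     (if even i then (\<Prod>l<i div 2. of_nat (2 * l + 1)) / (- 2 * a) ^ (i div 2) else 0))"
  unfolding gauss_mean_def using assms
  by (intro sum.mono_neutral_left) (auto simp: coeff_eq_0)

lemma gauss_mean_add: "gauss_mean a (p + q) = gauss_mean a p + gauss_mean a q"
proof -
  define N where "N = max (degree p) (degree q)"
  have "degree (p + q) \<le> N" "degree p \<le> N" "degree q \<le> N"
    unfolding N_def by (auto intro: degree_add_le)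
  then show ?thesis
    by (simp only: gauss_mean_superset[of _ N] sum.distrib[symmetric] coeff_add distrib_right)
qed

lemma gauss_mean_smult: "gauss_mean a (smult r p) = r * gauss_mean a p"
  using degree_smult_le[of r p]
  by (simp only: gauss_mean_superset[of _ "degree p"] sum_distrib_left coeff_smult mult.assoc)

lemma gauss_mean_sum: "gauss_mean a (\<Sum>i\<in>A. f i) = (\<Sum>i\<in>A. gauss_mean a (f i))"
proof (induction A rule: infinite_finite_induct)
  case (insert x A)
  then show ?case by (simp add: gauss_mean_add)
qed (simp_all add: gauss_mean_def)

lemma gauss_mean_odd:
  assumes "\<And>i. even i \<Longrightarrow> coeff p i = 0"
  shows "gauss_mean a p = 0"
  unfolding gauss_mean_def using assms by (intro sum.neutral) auto

lemma gauss_mean_rat_adjoin: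
  assumes a: "a \<in> rat_adjoin b" and p: "\<And>i. coeff p i \<in> rat_adjoin b"
  shows "gauss_mean a p \<in> rat_adjoin b"
proof -
  have "(\<Prod>l<k. of_nat (2 * l + 1)) / (- 2 * a) ^ k \<in> rat_adjoin b" for k
  proof -
    have "of_nat (\<Prod>l<k. 2 * l + 1) / (of_rat (- 2) * a) ^ k \<in> rat_adjoin b"
      by (intro rat_adjoin_divide rat_adjoin_mult rat_adjoin_power rat_adjoin_of_nat rat_adjoin_of_rat a)
    then show ?thesis by (simp add: of_rat_minus)
  qed
  then show ?thesis unfolding gauss_mean_def
    by (auto intro!: rat_adjoin_sum rat_adjoin_mult p rat_adjoin_0)
qed

text \<open>
  The coefficient \<open>c\<^sub>k\<close> of \<open>\<hbar>\<^sup>k\<close> as a polynomial in \<open>\<lambda>\<close>: the coefficient of \<open>\<lambda>\<^sup>j\<close> is the mean of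
  \<open>y\<^sup>j/j!\<close> times the coefficient of \<open>t\<^bsup>2k-j\<^esup>\<close> in the exponential of the phase at \<open>\<lambda> = 0\<close>.
\<close>

definition phase_coeff :: "(nat \<Rightarrow> nat \<Rightarrow> complex) \<Rightarrow> nat \<Rightarrow> complex poly" where
  "phase_coeff v k = (\<Sum>j\<le>2 * k.
     monom (gauss_mean (v 0 2) (monom 1 j * fps_nth (fps_poly_exp (phase_exponent v 0)) (2 * k - j)) / fact j) j)"

lemma poly_phase_coeff:
  "gauss_integral (v 0 2) (fps_nth (fps_poly_exp (phase_exponent v lam)) (2 * k)) =
     csqrt (of_real pi / (- v 0 2)) * poly (phase_coeff v k) lam"
proof -
  have lin: "monom lam 1 ^ j * G = smult (lam ^ j) (monom 1 j * G)" for j and G :: "complex poly"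
    by (simp add: monom_power smult_monom flip: mult_smult_left)
  show ?thesis
    unfolding phase_exponent_split[of v lam] fps_poly_exp_linear_term gauss_integral_eq phase_coeff_def
      lin gauss_mean_sum gauss_mean_smult
    by (simp add: poly_sum poly_monom mult_ac)
qed

lemma phase_expansion_odd:
  assumes v: "\<And>n m. 2 \<le> n + m \<Longrightarrow> v n m \<in> rat_adjoin a" and "odd d"
  shows "gauss_integral b (fps_nth (fps_poly_exp (phase_exponent v lam)) d) = 0"
proof -
  define G where "G e = fps_nth (fps_poly_exp (phase_exponent v 0)) e" for e
  have "graded_fps (rat_adjoin a) (fps_poly_exp (phase_exponent v 0))"
    by (intro graded_fps_poly_exp graded_phase_exponent v)
  then have odd_G: "coeff (G e) i = 0" if "odd (e + i)" for e i
    unfolding G_def using that by (rule graded_fps_odd)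
  have "gauss_mean b (monom lam 1 ^ j * G (d - j)) = 0" if "j \<le> d" for j
  proof (rule gauss_mean_odd)
    fix i :: nat assume "even i"
    then have "odd (d - j + (i - j))" if "j \<le> i" using \<open>odd d\<close> \<open>j \<le> d\<close> that by presburger
    then have "j \<le> i \<Longrightarrow> coeff (G (d - j)) (i - j) = 0"
      using odd_G by blast
    then show "coeff (monom lam 1 ^ j * G (d - j)) i = 0"
      by (simp add: monom_power coeff_monom_mult)
  qed
  then show ?thesis
    unfolding phase_exponent_split[of v lam] fps_poly_exp_linear_term gauss_integral_eq
    by (simp add: gauss_mean_sum gauss_mean_smult flip: G_def)
qed

lemma coeff_phase_coeff:
  "coeff (phase_coeff v k) i = (if i \<le> 2 * k then
     gauss_mean (v 0 2) (monom 1 i * fps_nth (fps_poly_exp (phase_exponent v 0)) (2 * k - i)) / fact i else 0)"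
proof -
  define g where "g j = gauss_mean (v 0 2) (monom 1 j * fps_nth (fps_poly_exp (phase_exponent v 0)) (2 * k - j)) / fact j" for j
  have "coeff (phase_coeff v k) i = (\<Sum>j\<le>2 * k. if i = j then g j else 0)"
    by (simp add: phase_coeff_def coeff_sum eq_commute flip: g_def)
  then show ?thesis by (simp flip: g_def)
qed

lemma fps_poly_exp_nth_0: "fps_nth (fps_poly_exp F) 0 = 1"
  by (simp add: fps_poly_exp_def)

lemma phase_coeff_rat_adjoin:
  assumes v: "\<And>n m. 2 \<le> n + m \<Longrightarrow> v n m \<in> rat_adjoin a"
  shows "coeff (phase_coeff v k) i \<in> rat_adjoin a"
proof -
  have "coeff (fps_nth (fps_poly_exp (phase_exponent v 0)) e) i \<in> rat_adjoin a" for e i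
    by (intro graded_fps_coeff graded_fps_poly_exp graded_phase_exponent v)
  then show ?thesis using v[of 0 2]
    by (auto simp: coeff_phase_coeff coeff_monom_mult
        intro!: rat_adjoin_divide rat_adjoin_fact gauss_mean_rat_adjoin rat_adjoin_0)
qed

text \<open>
  At \<open>j = 2k\<close> only the constant term of the exponential of the phase is left, so the top coefficient
  is the mean of \<open>y\<^bsup>2k\<^esup>/(2k)!\<close>, that is
  \<open>(2k-1)!!/((2k)! (-2 v\<^bsub>0,2\<^esub>)\<^sup>k)\<close>.
\<close>

lemma degree_phase_coeff:
  assumes "v 0 2 \<noteq> 0"
  shows "degree (phase_coeff v k) = 2 * k"
proof (rule antisym)
  show "degree (phase_coeff v k) \<le> 2 * k"
    by (rule degree_le) (simp add: coeff_phase_coeff)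
  have "gauss_mean (v 0 2) (monom 1 (2 * k)) = (\<Prod>l<k. of_nat (2 * l + 1)) / (- 2 * v 0 2) ^ k"
    by (simp add: gauss_mean_def degree_monom_eq if_distrib[of "\<lambda>x. x * _"] sum.delta cong: if_cong)
  moreover have "(\<Prod>l<k. of_nat (2 * l + 1)) \<noteq> (0 :: complex)"
    unfolding of_nat_prod[symmetric] of_nat_eq_0_iff by simp
  ultimately have "coeff (phase_coeff v k) (2 * k) \<noteq> 0"
    using assms by (simp add: coeff_phase_coeff fps_poly_exp_nth_0)
  then show "2 * k \<le> degree (phase_coeff v k)" by (rule le_degree)
qed

lemma phase_coeff_0: "phase_coeff v 0 = 1"
  by (simp add: phase_coeff_def fps_poly_exp_nth_0 gauss_mean_def monom_0 one_pCons)

section \<open>The stationary phase expansion\<close>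

lemma fps_compose_X2_nth:
  "fps_nth (Abs_fps c oo fps_X ^ 2) d = (if even d then c (d div 2) else (0 :: complex))"
proof -
  have "fps_nth (Abs_fps c oo fps_X ^ 2) d = (\<Sum>i=0..d. if d = 2 * i then c i else 0)"
    by (simp add: fps_compose_nth fps_X_power_nth flip: power_mult) (intro sum.cong; simp)
  also have "\<dots> = (if even d then c (d div 2) else 0)"
    by (cases "even d") (auto elim!: evenE intro!: sum.neutral)
  finally show ?thesis .
qed

lemma stationary_phase_expansion_eq:
  assumes cp: "critical_point lam' \<alpha> z0 LA LB"
  shows "\<exists>\<delta>. \<delta>\<^sup>2 = \<i> * Delta \<alpha> \<and>
          stationary_phase_expansion lam lam' z0 LA LB =
            wave_exp (2 * pi * \<i> * of_int lam' * z0) \<odot>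
            wave_exp (2 * LA 2 (- \<alpha>) - LB 2 (1 / \<alpha>\<^sup>2)) \<odot>
            wave_const (\<alpha> powi lam / \<delta>) \<odot>
            wave_hbar_series (\<lambda>k. poly (phase_coeff (critical_V \<alpha>) k) (of_int lam))"
proof -
  note b = critical_point_branches[OF cp]
  define v where "v = V_taylor LA LB z0"
  define w where "w = critical_V \<alpha>"
  define M where "M = csqrt (of_real pi / (- w 0 2))"
  define S where "S = \<i> * exp (v 1 0) / csqrt (2 * pi * \<i>) * M"
  have vw: "v n m = w n m" if "2 \<le> n + m" for n m
    unfolding v_def w_def using V_taylor_critical_V[OF b(2,3) that] b(1) by simp
  have phase: "phase_exponent v l = phase_exponent w l" for l
    using vw by (rule phase_exponent_cong)
  have "S\<^sup>2 = inverse (\<i> * Delta \<alpha>)"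
    unfolding S_def M_def v_def w_def by (rule prefactor_square[OF cp])
  then have "(1 / S)\<^sup>2 = \<i> * Delta \<alpha>"
    unfolding power_divide power_one by (simp only: inverse_inverse_eq flip: inverse_eq_divide)
  moreover have "v 0 0 = 2 * LA 2 (- \<alpha>) - LB 2 (1 / \<alpha>\<^sup>2)"
    unfolding v_def V_taylor_eq[OF b(2,3)] using b(1,4) V_weight_values by simp
  moreover have "fps_const (\<i> * exp z0 powi lam * exp (v 1 0) / csqrt (2 * pi * \<i>)) *
      Abs_fps (\<lambda>d. gauss_integral (v 0 2) (fps_nth (fps_poly_exp (phase_exponent v (of_int lam))) d))
    = fps_const (\<alpha> powi lam / (1 / S)) * (Abs_fps (\<lambda>k. poly (phase_coeff w k) (of_int lam)) oo fps_X ^ 2)"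
  proof (rule fps_ext)
    fix d
    have "gauss_integral (w 0 2) (fps_nth (fps_poly_exp (phase_exponent w (of_int lam))) d)
        = M * fps_nth (Abs_fps (\<lambda>k. poly (phase_coeff w k) (of_int lam)) oo fps_X ^ 2) d"
    proof (cases "even d")
      case True
      then show ?thesis unfolding fps_compose_X2_nth M_def
        by (auto elim!: evenE simp: poly_phase_coeff)
    next
      case False
      have "w n m \<in> rat_adjoin \<alpha>" for n m unfolding w_def by (rule critical_V_rat_adjoin)
      from phase_expansion_odd[OF this False] show ?thesis
        unfolding fps_compose_X2_nth using False by simp
    qed
    then show "fps_nth (fps_const (\<i> * exp z0 powi lam * exp (v 1 0) / csqrt (2 * pi * \<i>)) *
        Abs_fps (\<lambda>d. gauss_integral (v 0 2) (fps_nth (fps_poly_exp (phase_exponent v (of_int lam))) d))) d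
      = fps_nth (fps_const (\<alpha> powi lam / (1 / S)) * (Abs_fps (\<lambda>k. poly (phase_coeff w k) (of_int lam)) oo fps_X ^ 2)) d"
      by (simp add: vw phase S_def flip: b(1))
  qed
  ultimately show ?thesis
    by (intro exI[of _ "1 / S"])
       (simp add: stationary_phase_expansion_def Let_def wave_times_def wave_exp_def wave_const_def
          wave_hbar_series_def flip: v_def w_def)
qed

theorem theorem5:
  "\<exists>c :: complex \<Rightarrow> nat \<Rightarrow> complex poly.
     \<forall>(lam::int) (lam'::int) \<alpha> z0 LA LB. critical_point lam' \<alpha> z0 LA LB \<longrightarrow>
       (\<alpha> ^ 3 - \<alpha> - 1) * (\<alpha> ^ 3 + 2 * \<alpha>\<^sup>2 - \<alpha> - 1) = 0 \<and>
       Delta \<alpha> \<noteq> 0 \<and>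
       c \<alpha> 0 = 1 \<and>
       (\<forall>k. degree (c \<alpha> k) = 2 * k \<and> (\<forall>i. coeff (c \<alpha> k) i \<in> rat_adjoin \<alpha>)) \<and>
       (\<exists>\<delta>. \<delta>\<^sup>2 = \<i> * Delta \<alpha> \<and>
          stationary_phase_expansion lam lam' z0 LA LB =
            wave_exp (2 * pi * \<i> * of_int lam' * z0) \<odot>
            wave_exp (2 * LA 2 (- \<alpha>) - LB 2 (1 / \<alpha>\<^sup>2)) \<odot>
            wave_const (\<alpha> powi lam / \<delta>) \<odot>
            wave_hbar_series (\<lambda>k. poly (c \<alpha> k) (of_int lam)))"
proof (rule exI[of _ "\<lambda>\<alpha>. phase_coeff (critical_V \<alpha>)"], intro allI impI)
  fix lam lam' :: int and \<alpha> z0 :: complex and LA LB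
  assume cp: "critical_point lam' \<alpha> z0 LA LB"
  note nz = critical_point_branches(5)[OF cp]
  note alg = critical_point_algebra[OF nz critical_point_equation[OF cp]]
  have "Delta \<alpha> \<noteq> 0" using alg(2,3) nz by (simp add: alg(4))
  moreover have "critical_V \<alpha> 0 2 \<noteq> 0"
    unfolding critical_V_02[OF alg(2)] using alg(2,3) by (simp only: divide_eq_0_iff neg_equal_0_iff_equal) simp
  ultimately show "(\<alpha> ^ 3 - \<alpha> - 1) * (\<alpha> ^ 3 + 2 * \<alpha>\<^sup>2 - \<alpha> - 1) = 0 \<and>
       Delta \<alpha> \<noteq> 0 \<and>
       phase_coeff (critical_V \<alpha>) 0 = 1 \<and>
       (\<forall>k. degree (phase_coeff (critical_V \<alpha>) k) = 2 * k \<and>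
          (\<forall>i. coeff (phase_coeff (critical_V \<alpha>) k) i \<in> rat_adjoin \<alpha>)) \<and>
       (\<exists>\<delta>. \<delta>\<^sup>2 = \<i> * Delta \<alpha> \<and>
          stationary_phase_expansion lam lam' z0 LA LB =
            wave_exp (2 * pi * \<i> * of_int lam' * z0) \<odot>
            wave_exp (2 * LA 2 (- \<alpha>) - LB 2 (1 / \<alpha>\<^sup>2)) \<odot>
            wave_const (\<alpha> powi lam / \<delta>) \<odot>
            wave_hbar_series (\<lambda>k. poly (phase_coeff (critical_V \<alpha>) k) (of_int lam)))"
    using alg(1) phase_coeff_0 degree_phase_coeff phase_coeff_rat_adjoin[of "critical_V \<alpha>" \<alpha>] critical_V_rat_adjoin
      stationary_phase_expansion_eq[OF cp] by simp
qed

end
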